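(* Let $F=\bigcup_c F_c$ be a non-matching interface of the mesh between an active coarse cell $K$ and active fine cells $K_c'$, $c=1,\dots,2^{d-1}$, let $K_c\subset K$ be the shadow child of $K$ adjacent to the subface $F_c=\partial K_c\cap\partial K_c'$, and let $\mathcal P_K$ be the parent-to-children polynomial embedding. Let $u,v\in\mathbb V_{DG}$ be arbitrary elements of the broken space on the active mesh, and let both sides of the identity below use the fine-level penalty $\sigma_{F_c}$ on every subface $F_c$. Then $$\sum_{c} a_{F_c}\bigl(\{u|_{K_c'},\,(\mathcal P_K u|_K)|_{K_c}\},\ \{v|_{K_c'},\,(\mathcal P_K v|_K)|_{K_c}\}\bigr)\;=\;\sum_{c} a_{F_c}\bigl(\{u|_{K_c'},\,u|_K\},\ \{v|_{K_c'},\,v|_K\}\bigr),$$ where the right-hand side is the standard non-matching symmetric interior penalty (SIPG) contribution of $F$. Moreover, the identity also holds for the values computed by quadrature: if, on the left, each integral over $F_c$ is replaced by the same-level quadrature rule on the matching fine-shadow face $F_c$, and, on the right, each integral over $F_c$ is replaced by the dedicated subface rule on $F_c$, then the two rules are applied to the same integrand over the same subface $F_c$ and the two sides remain equal.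
   Context: Setting. Let $d\in\{2,3\}$ and let $p$ be the polynomial degree. The active mesh is a Cartesian mesh $\mathcal T_{\mathrm{act}}$ of axis-aligned cells (each a scaled translate of the reference cube $[0,1]^d$), obtained by hierarchical refinement in which a cell is bisected in every direction into $2^d$ congruent children. The mesh is 2:1 balanced: adjacent active cells differ by at most one refinement level. $\mathbb Q_p(K)$ denotes the polynomials on $K$ of degree at most $p$ in each variable, and $\mathbb V_{DG}=\{w: w|_K\in\mathbb Q_p(K)\ \text{for every } K\in\mathcal T_{\mathrm{act}}\}$ is the broken space, with no continuity between cells. Non-matching interface. A non-matching interface is a face $F$ of an active coarse cell $K$ across which $K$ abuts $2^{d-1}$ active cells $K_1',\dots,K_{2^{d-1}}'$ of the next finer level. The $2^d$ children of $K$ under bisection are called its shadow cells (they are auxiliary cells, not active cells). For each $c=1,\dots,2^{d-1}$, $K_c$ denotes the shadow child of $K$ adjacent to $K_c'$ across $F$, and $F_c=\partial K_c\cap\partial K_c'$ is the corresponding subface, which is a full face of both $K_c$ and $K_c'$, so that $F=\bigcup_c F_c$. Embedding. $\mathcal P_K:\mathbb Q_p(K)\to\prod_{c}\mathbb Q_p(K_c)$ (product over the children of $K$) is the parent-to-children polynomial embedding: it represents a polynomial $w\in\mathbb Q_p(K)$ on each child by its restriction, $(\mathcal P_K w)|_{K_c}=w|_{K_c}$. In coefficients it is realized by the tensor-product matrices $\bigotimes_{i=1}^d\mathcal P_{b_i}$, where $b\in\{0,1\}^d$ is the position of the child within its parent and $\mathcal P_0,\mathcal P_1$ are the $(p+1)\times(p+1)$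 one-dimensional matrices expressing a polynomial of degree at most $p$ on $[0,1]$ in the (rescaled) basis on the left and right half interval, respectively. Face form. For a face (or subface) $G$ with unit normal $n$ and with polynomial data given on its two sides, the SIPG face form is $$a_G(u,v)=-\int_G\Bigl(\{\!\{\partial_n u\}\!\}\,[\![v]\!]+[\![u]\!]\,\{\!\{\partial_n v\}\!\}-\sigma_G\,[\![u]\!]\,[\![v]\!]\Bigr)\,ds,$$ where, with sides labelled $-$ and $+$ and $n$ pointing from the $-$ side to the $+$ side, $[\![w]\!]=w^--w^+$ and $\{\!\{\partial_n w\}\!\}=\tfrac12(\partial_n w^-+\partial_n w^+)$, all traces and normal derivatives being taken on $G$. The notation $\{w',w\}$ for an argument of $a_{F_c}$ means that $w'$ is the function on the fine side (the side of $K_c'$) and $w$ the function on the coarse side (the side of $K$). The fine-level penalty $\sigma_{F_c}\sim p^2/h_{F_c}$ is a constant on $F_c$ determined by the fine cell size $h_{F_c}$; the same value is used on both sides of the identity. Quadrature. Fix a quadrature rule on the reference face $[0,1]^{d-1}$. The same-level rule on the fine-shadow face $F_c$ is the image of this rule under the affine map from $[0,1]^{d-1}$ onto $F_c$, regarded as a face of the fine-level cells $K_c$ and $K_c'$. The dedicated subface rule is the rule used by a standard non-matching face kernel: the reference rule is shifted and scaled to the subface of the reference face of $K$ corresponding to $F_c$ and then mapped to $F$, with traces of $u|_K$, $v|_K$ evaluated at the resulting points. *)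

theory Defs
  imports "HOL-Analysis.Analysis"
begin

section \<open>Cells and meshes\<close>

datatype ('d::finite) cell = Cell (corner: "real^'d") (edge: real) (lev: nat)

definition cell_set :: "'d::finite cell \<Rightarrow> (real^'d) set" where
  "cell_set K = cbox (corner K) (corner K + edge K *\<^sub>R 1)"

definition child :: "'d::finite cell \<Rightarrow> bool^'d \<Rightarrow> 'd cell" where
  "child K b = Cell (corner K + (edge K / 2) *\<^sub>R (\<chi> i. of_bool (b $ i))) (edge K / 2) (Suc (lev K))"

definition children :: "'d::finite cell \<Rightarrow> 'd cell set" where
  "children K = range (child K)"

definition child_pos :: "'d::finite cell \<Rightarrow> 'd cell \<Rightarrow> bool^'d" where
  "child_pos K C = (THE b. C = child K b)"

definition root_mesh :: "'d::finite cell set \<Rightarrow> bool" where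
  "root_mesh R \<longleftrightarrow> finite R \<and>
     (\<exists>x0 h0. h0 > 0 \<and>
        (\<forall>K\<in>R. lev K = 0 \<and> edge K = h0 \<and>
           (\<exists>k :: int^'d. corner K = x0 + h0 *\<^sub>R (\<chi> i. of_int (k $ i)))))"

inductive hierarchical_mesh :: "'d::finite cell set \<Rightarrow> bool" where
  root: "root_mesh R \<Longrightarrow> hierarchical_mesh R"
| refine: "hierarchical_mesh T \<Longrightarrow> K \<in> T \<Longrightarrow> hierarchical_mesh ((T - {K}) \<union> children K)"

text \<open>Cells are adjacent when they share a piece of a face, not merely a vertex or (for
  \<open>d = 3\<close>) an edge. Requiring 2:1 balance only for such pairs is the weakest form of the
  condition.\<close>

definition adjacent :: "'d::finite cell \<Rightarrow> 'd cell \<Rightarrow> bool" where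
  "adjacent K K' \<longleftrightarrow> aff_dim (cell_set K \<inter> cell_set K') = int CARD('d) - 1"

definition balanced :: "'d::finite cell set \<Rightarrow> bool" where
  "balanced T \<longleftrightarrow> (\<forall>K\<in>T. \<forall>K'\<in>T. adjacent K K' \<longrightarrow> lev K \<le> lev K' + 1 \<and> lev K' \<le> lev K + 1)"

definition active_mesh :: "'d::finite cell set \<Rightarrow> bool" where
  "active_mesh T \<longleftrightarrow> hierarchical_mesh T \<and> balanced T"


section \<open>Non-matching interfaces\<close>

text \<open>A face of a cell is given by its normal axis \<open>j\<close> and by whether it is the upper
  (\<open>s = True\<close>) or the lower one of the two faces with that normal axis.\<close>

definition face_coord :: "'d::finite cell \<Rightarrow> 'd \<Rightarrow> bool \<Rightarrow> real" where
  "face_coord K j s = corner K $ j + (if s then edge K else 0)"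

definition face :: "'d::finite cell \<Rightarrow> 'd \<Rightarrow> bool \<Rightarrow> (real^'d) set" where
  "face K j s = {x \<in> cell_set K. x $ j = face_coord K j s}"

definition outer_normal :: "'d::finite \<Rightarrow> bool \<Rightarrow> real^'d" where
  "outer_normal j s = (if s then axis j 1 else - axis j 1)"

definition abuts_across :: "(real^'d) set \<Rightarrow> 'd::finite cell \<Rightarrow> 'd cell \<Rightarrow> bool" where
  "abuts_across F K K' \<longleftrightarrow> adjacent K K' \<and> cell_set K \<inter> cell_set K' \<subseteq> F"

definition nonmatching_interface ::
    "'d::finite cell set \<Rightarrow> 'd cell \<Rightarrow> 'd \<Rightarrow> bool \<Rightarrow> (nat \<Rightarrow> 'd cell) \<Rightarrow> bool" where
  "nonmatching_interface T K j s K' \<longleftrightarrow> K \<in> T \<and>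
     inj_on K' {1..2 ^ (CARD('d) - 1)} \<and>
     (\<forall>c\<in>{1..2 ^ (CARD('d) - 1)}.
        K' c \<in> T \<and> lev (K' c) = lev K + 1 \<and> abuts_across (face K j s) K (K' c))"

definition shadow_child :: "'d::finite cell \<Rightarrow> 'd \<Rightarrow> bool \<Rightarrow> 'd cell \<Rightarrow> 'd cell \<Rightarrow> bool" where
  "shadow_child K j s K' C \<longleftrightarrow> C \<in> children K \<and> abuts_across (face K j s) C K'"

definition subface :: "'d::finite cell \<Rightarrow> 'd cell \<Rightarrow> (real^'d) set" where
  "subface C K' = frontier (cell_set C) \<inter> frontier (cell_set K')"


section \<open>Polynomials, broken space and embedding\<close>

definition multi_idx :: "nat \<Rightarrow> ('d::finite \<Rightarrow> nat) set" where
  "multi_idx p = (UNIV \<rightarrow>\<^sub>E {..p})"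

definition Qpoly :: "nat \<Rightarrow> (real^'d::finite) set \<Rightarrow> (real^'d \<Rightarrow> real) set" where
  "Qpoly p S = {restrict (\<lambda>x. \<Sum>\<alpha>\<in>multi_idx p. a \<alpha> * (\<Prod>i\<in>UNIV. x $ i ^ \<alpha> i)) S | a. True}"

text \<open>A broken function has several values on a face shared by cells, so it is represented by
  the family of its restrictions: \<open>w K\<close> stands for \<open>w|\<^sub>K\<close>, a function on the closed cell.\<close>

definition V_DG :: "'d::finite cell set \<Rightarrow> nat \<Rightarrow> ('d cell \<Rightarrow> real^'d \<Rightarrow> real) set" where
  "V_DG T p = (\<Pi> K\<in>T. Qpoly p (cell_set K))"

definition embedding :: "'d::finite cell \<Rightarrow> (real^'d \<Rightarrow> real) \<Rightarrow> 'd cell \<Rightarrow> real^'d \<Rightarrow> real" where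
  "embedding K w = (\<lambda>C\<in>children K. restrict w (cell_set C))"

lemma child_subset:
  assumes "edge K \<ge> 0"
  shows "cell_set (child K b) \<subseteq> cell_set K"
proof
  fix x assume x: "x \<in> cell_set (child K b)"
  have "corner K $ i \<le> x $ i \<and> x $ i \<le> corner K $ i + edge K" for i
  proof -
    have "corner K $ i + edge K / 2 * of_bool (b $ i) \<le> x $ i"
      "x $ i \<le> corner K $ i + edge K / 2 * of_bool (b $ i) + edge K / 2"
      using x by (simp_all add: cell_set_def child_def mem_box_cart)
    then show ?thesis using assms by (cases "b $ i") auto
  qed
  then show "x \<in> cell_set K" by (simp add: cell_set_def mem_box_cart)
qed

lemma embedding_Qpoly:
  assumes "edge K \<ge> 0" "w \<in> Qpoly p (cell_set K)"
  shows "embedding K w \<in> (\<Pi>\<^sub>E C\<in>children K. Qpoly p (cell_set C))"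
proof -
  from assms(2) obtain a where
    w: "w = restrict (\<lambda>x. \<Sum>\<alpha>\<in>multi_idx p. a \<alpha> * (\<Prod>i\<in>UNIV. x $ i ^ \<alpha> i)) (cell_set K)"
    unfolding Qpoly_def by blast
  have "restrict w (cell_set C) \<in> Qpoly p (cell_set C)" if C: "C \<in> children K" for C
  proof -
    have "cell_set K \<inter> cell_set C = cell_set C"
      using child_subset[OF assms(1)] C unfolding children_def by blast
    then show ?thesis unfolding Qpoly_def w restrict_restrict by auto
  qed
  then show ?thesis unfolding embedding_def by auto
qed

definition ref_coord :: "'d::finite cell \<Rightarrow> real^'d \<Rightarrow> real^'d" where
  "ref_coord K x = (1 / edge K) *\<^sub>R (x - corner K)"

text \<open>In the coefficients with respect to a tensor-product basis \<open>\<phi>\<close>, the restriction to the child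
  at position \<open>b\<close> is the Kronecker product of the one-dimensional matrices \<open>P (b $ i)\<close>.\<close>

lemma embedding_tensor_product:
  fixes \<phi> :: "nat \<Rightarrow> real \<Rightarrow> real" and P :: "bool \<Rightarrow> nat \<Rightarrow> nat \<Rightarrow> real"
    and K :: "'d::finite cell"
  assumes P: "\<And>e k t. k \<le> p \<Longrightarrow> \<phi> k ((t + of_bool e) / 2) = (\<Sum>m\<le>p. P e m k * \<phi> m t)"
    and w: "\<And>x. x \<in> cell_set K \<Longrightarrow>
        w x = (\<Sum>\<alpha>\<in>multi_idx p. a \<alpha> * (\<Prod>i\<in>UNIV. \<phi> (\<alpha> i) (ref_coord K x $ i)))"
    and h: "edge K > 0" and x: "x \<in> cell_set (child K b)"
  shows "embedding K w (child K b) x =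
    (\<Sum>\<beta>\<in>multi_idx p. (\<Sum>\<alpha>\<in>multi_idx p. (\<Prod>i\<in>UNIV. P (b $ i) (\<beta> i) (\<alpha> i)) * a \<alpha>) *
       (\<Prod>i\<in>UNIV. \<phi> (\<beta> i) (ref_coord (child K b) x $ i)))"
proof -
  let ?y = "ref_coord (child K b) x"
  have xK: "x \<in> cell_set K" using child_subset[of K b] h x by auto
  have y: "ref_coord K x $ i = (?y $ i + of_bool (b $ i)) / 2" for i
    using h by (simp add: ref_coord_def child_def field_simps)
  have pr: "(\<Prod>i\<in>UNIV. \<phi> (\<alpha> i) (ref_coord K x $ i)) =
      (\<Sum>\<beta>\<in>multi_idx p. \<Prod>i\<in>UNIV. P (b $ i) (\<beta> i) (\<alpha> i) * \<phi> (\<beta> i) (?y $ i))"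
    if "\<alpha> \<in> multi_idx p" for \<alpha> :: "'d \<Rightarrow> nat"
  proof -
    have "\<alpha> i \<le> p" for i using that by (auto simp: multi_idx_def)
    then have "(\<Prod>i\<in>UNIV. \<phi> (\<alpha> i) (ref_coord K x $ i)) =
        (\<Prod>i\<in>UNIV. \<Sum>m\<le>p. P (b $ i) m (\<alpha> i) * \<phi> m (?y $ i))"
      by (simp add: y P)
    then show ?thesis unfolding multi_idx_def by (simp add: prod_sum_PiE)
  qed
  have "embedding K w (child K b) x = w x"
    using x by (simp add: embedding_def children_def)
  also have "\<dots> = (\<Sum>\<alpha>\<in>multi_idx p. \<Sum>\<beta>\<in>multi_idx p.
      a \<alpha> * (\<Prod>i\<in>UNIV. P (b $ i) (\<beta> i) (\<alpha> i) * \<phi> (\<beta> i) (?y $ i)))"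
    unfolding w[OF xK] by (intro sum.cong) (simp_all add: pr sum_distrib_left)
  also have "\<dots> = (\<Sum>\<beta>\<in>multi_idx p. \<Sum>\<alpha>\<in>multi_idx p.
      a \<alpha> * (\<Prod>i\<in>UNIV. P (b $ i) (\<beta> i) (\<alpha> i) * \<phi> (\<beta> i) (?y $ i)))"
    by (rule sum.swap)
  finally show ?thesis
    by (simp add: prod.distrib sum_distrib_right mult.assoc mult.left_commute)
qed


section \<open>Face form\<close>

text \<open>One-sided normal derivative: the derivative along \<open>n\<close> of a function on the closed cell \<open>C\<close>.\<close>

definition normal_deriv ::
    "'d::finite cell \<Rightarrow> real^'d \<Rightarrow> (real^'d \<Rightarrow> real) \<Rightarrow> real^'d \<Rightarrow> real" where
  "normal_deriv C n w x =
     vector_derivative (\<lambda>t. w (x + t *\<^sub>R n)) (at 0 within {t. x + t *\<^sub>R n \<in> cell_set C})"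

definition jump :: "(real^'d::finite \<Rightarrow> real) \<times> (real^'d \<Rightarrow> real) \<Rightarrow> real^'d \<Rightarrow> real" where
  "jump w x = fst w x - snd w x"

definition avg_normal_deriv ::
    "'d::finite cell \<times> 'd cell \<Rightarrow> real^'d \<Rightarrow> (real^'d \<Rightarrow> real) \<times> (real^'d \<Rightarrow> real) \<Rightarrow> real^'d \<Rightarrow> real" where
  "avg_normal_deriv C n w x =
     (normal_deriv (fst C) n (fst w) x + normal_deriv (snd C) n (snd w) x) / 2"

text \<open>First components belong to the \<open>-\<close> side, second components to the \<open>+\<close> side, and \<open>n\<close> points
  from \<open>-\<close> to \<open>+\<close>; \<open>C\<close> holds the cells that carry the data on the two sides.\<close>

definition sip_integrand ::
    "'d::finite cell \<times> 'd cell \<Rightarrow> real^'d \<Rightarrow> real \<Rightarrow>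
     (real^'d \<Rightarrow> real) \<times> (real^'d \<Rightarrow> real) \<Rightarrow> (real^'d \<Rightarrow> real) \<times> (real^'d \<Rightarrow> real) \<Rightarrow> real^'d \<Rightarrow> real" where
  "sip_integrand C n \<sigma> u v x =
     avg_normal_deriv C n u x * jump v x + jump u x * avg_normal_deriv C n v x
       - \<sigma> * jump u x * jump v x"

text \<open>Throughout, \<open>\<tau> :: 'e \<Rightarrow> 'd\<close> enumerates the axes other than \<open>j\<close>, so that \<open>'e\<close> has
  \<open>d - 1\<close> elements. For fixed \<open>t\<close>, \<open>plane_point \<tau> j t\<close> is an isometry from \<open>real^'e\<close> onto the
  hyperplane \<open>x $ j = t\<close>; surface measure there is the image of Lebesgue measure.\<close>

definition plane_point :: "('e::finite \<Rightarrow> 'd::finite) \<Rightarrow> 'd \<Rightarrow> real \<Rightarrow> real^'e \<Rightarrow> real^'d" where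
  "plane_point \<tau> j t y = (\<chi> i. if i = j then t else y $ inv \<tau> i)"

definition surface_integral ::
    "('e::finite \<Rightarrow> 'd::finite) \<Rightarrow> 'd \<Rightarrow> real \<Rightarrow> (real^'d) set \<Rightarrow> (real^'d \<Rightarrow> real) \<Rightarrow> real" where
  "surface_integral \<tau> j t G f =
     (LINT y : plane_point \<tau> j t -` G | lborel. f (plane_point \<tau> j t y))"

definition sip_form ::
    "('e::finite \<Rightarrow> 'd::finite) \<Rightarrow> 'd \<Rightarrow> real \<Rightarrow> (real^'d) set \<Rightarrow> 'd cell \<times> 'd cell \<Rightarrow> real^'d \<Rightarrow> real \<Rightarrow>
     (real^'d \<Rightarrow> real) \<times> (real^'d \<Rightarrow> real) \<Rightarrow> (real^'d \<Rightarrow> real) \<times> (real^'d \<Rightarrow> real) \<Rightarrow> real" where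
  "sip_form \<tau> j t G C n \<sigma> u v = - surface_integral \<tau> j t G (sip_integrand C n \<sigma> u v)"

text \<open>\<open>\<sigma> h \<sim> p\<^sup>2 / h\<close>, read as two-sided comparability in the cell size \<open>h\<close>.\<close>

definition penalty :: "nat \<Rightarrow> (real \<Rightarrow> real) \<Rightarrow> bool" where
  "penalty p \<sigma> \<longleftrightarrow> (\<exists>c1>0. \<exists>c2>0. \<forall>h>0.
     c1 * (real p ^ 2 / h) \<le> \<sigma> h \<and> \<sigma> h \<le> c2 * (real p ^ 2 / h))"


section \<open>Quadrature\<close>

text \<open>A quadrature rule is a list of (node, weight) pairs.\<close>

definition reference_rule :: "((real^'e::finite) \<times> real) list \<Rightarrow> bool" where
  "reference_rule Q \<longleftrightarrow> (\<forall>(\<xi>, w) \<in> set Q. \<xi> \<in> cbox 0 1)"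

definition map_rule :: "('a \<Rightarrow> 'b) \<Rightarrow> real \<Rightarrow> ('a \<times> real) list \<Rightarrow> ('b \<times> real) list" where
  "map_rule \<Phi> J Q = map (\<lambda>(\<xi>, w). (\<Phi> \<xi>, J * w)) Q"

definition apply_rule :: "('a \<times> real) list \<Rightarrow> ('a \<Rightarrow> real) \<Rightarrow> real" where
  "apply_rule Q f = (\<Sum>(x, w)\<leftarrow>Q. w * f x)"

definition sip_quad ::
    "((real^'d) \<times> real) list \<Rightarrow> 'd::finite cell \<times> 'd cell \<Rightarrow> real^'d \<Rightarrow> real \<Rightarrow>
     (real^'d \<Rightarrow> real) \<times> (real^'d \<Rightarrow> real) \<Rightarrow> (real^'d \<Rightarrow> real) \<times> (real^'d \<Rightarrow> real) \<Rightarrow> real" where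
  "sip_quad Q C n \<sigma> u v = - apply_rule Q (sip_integrand C n \<sigma> u v)"

definition face_map ::
    "('e::finite \<Rightarrow> 'd::finite) \<Rightarrow> 'd cell \<Rightarrow> 'd \<Rightarrow> bool \<Rightarrow> real^'e \<Rightarrow> real^'d" where
  "face_map \<tau> K j s \<xi> = corner K + edge K *\<^sub>R plane_point \<tau> j (of_bool s) \<xi>"

text \<open>Shift and scaling of the reference face of \<open>K\<close> to the subface covered by the child \<open>C\<close>;
  the relevant position is the tangential part of that of \<open>C\<close> in \<open>K\<close>.\<close>

definition ref_subface_map ::
    "('e::finite \<Rightarrow> 'd::finite) \<Rightarrow> 'd cell \<Rightarrow> 'd cell \<Rightarrow> real^'e \<Rightarrow> real^'e" where
  "ref_subface_map \<tau> K C \<xi> = (1 / 2) *\<^sub>R (\<xi> + (\<chi> i. of_bool (child_pos K C $ \<tau> i)))"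

definition same_level_rule ::
    "('e::finite \<Rightarrow> 'd::finite) \<Rightarrow> 'd cell \<Rightarrow> 'd \<Rightarrow> bool \<Rightarrow> ((real^'e) \<times> real) list \<Rightarrow> ((real^'d) \<times> real) list" where
  "same_level_rule \<tau> C j s Q = map_rule (face_map \<tau> C j s) (edge C ^ CARD('e)) Q"

definition subface_rule ::
    "('e::finite \<Rightarrow> 'd::finite) \<Rightarrow> 'd cell \<Rightarrow> 'd cell \<Rightarrow> 'd \<Rightarrow> bool \<Rightarrow> ((real^'e) \<times> real) list \<Rightarrow> ((real^'d) \<times> real) list" where
  "subface_rule \<tau> K C j s Q =
     map_rule (face_map \<tau> K j s) (edge K ^ CARD('e))
       (map_rule (ref_subface_map \<tau> K C) ((1 / 2) ^ CARD('e)) Q)"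

end

theory Submission
  imports Defs
begin

text \<open>
  The embedding only restricts a polynomial to a smaller cell, so on a subface both face forms
  see the same traces, and the whole content is geometric: \<open>F\<^sub>c = \<partial>K\<^sub>c \<inter> \<partial>K'\<^sub>c\<close> has to be a full
  face of the shadow child \<open>K\<^sub>c\<close>, on the same side of \<open>K\<^sub>c\<close> as \<open>F\<close> is of \<open>K\<close>.

  This holds because refinement keeps all cells on nested dyadic grids
  (\<open>hierarchical_mesh_on_dyadic_grid\<close>). The shadow child and the fine cell have the same level, so
  their corners differ by an integer multiple of their common edge length along every axis. Their
  intersection is then a box which along every axis is a whole edge or a single point; as its
  dimension is \<open>d - 1\<close> and it lies in the hyperplane of \<open>F\<close>, the axis normal to \<open>F\<close> is the only
  one along which it is a point (\<open>equal_level_cells_meet_in_face\<close>).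

  Two consequences give the theorem. At a point of \<open>F\<^sub>c\<close> the inward normal segment stays in \<open>K\<^sub>c\<close>
  for a positive length, and the one-sided normal derivative depends only on the values on such a
  segment, so the derivatives taken in \<open>K\<^sub>c\<close> and in \<open>K\<close> coincide
  (\<open>normal_deriv_restrict_child\<close>); hence the integrands agree on \<open>F\<^sub>c\<close>. And the scaled and shifted
  reference subface is mapped by \<open>K\<close> exactly as the reference face is mapped by \<open>K\<^sub>c\<close>
  (\<open>face_map_ref_subface_map\<close>), so that the two quadrature rules have identical nodes and weights.
\<close>

section \<open>Nested dyadic grids\<close>

definition on_dyadic_grid :: "real^'d \<Rightarrow> real \<Rightarrow> 'd::finite cell \<Rightarrow> bool" where
  "on_dyadic_grid x0 h0 K \<longleftrightarrow> edge K = h0 / 2 ^ lev K \<and>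
     (\<exists>k :: int^'d. corner K = x0 + edge K *\<^sub>R (\<chi> i. of_int (k $ i)))"

lemma on_dyadic_grid_child:
  fixes K :: "'d::finite cell"
  assumes "on_dyadic_grid x0 h0 K"
  shows "on_dyadic_grid x0 h0 (child K b)"
proof -
  from assms obtain k :: "int^'d" where e: "edge K = h0 / 2 ^ lev K"
    and k: "corner K = x0 + edge K *\<^sub>R (\<chi> i. of_int (k $ i))"
    unfolding on_dyadic_grid_def by blast
  have "corner (child K b) =
      x0 + edge (child K b) *\<^sub>R (\<chi> i. of_int ((\<chi> i. 2 * k $ i + of_bool (b $ i)) $ i))"
    by (simp add: child_def k vec_eq_iff field_simps)
  moreover have "edge (child K b) = h0 / 2 ^ lev (child K b)"
    by (simp add: child_def e)
  ultimately show ?thesis unfolding on_dyadic_grid_def by blast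
qed

lemma hierarchical_mesh_on_dyadic_grid:
  assumes "hierarchical_mesh T"
  obtains x0 h0 where "h0 > 0" "\<And>K. K \<in> T \<Longrightarrow> on_dyadic_grid x0 h0 K"
proof -
  from assms have "\<exists>x0 h0. h0 > 0 \<and> (\<forall>K\<in>T. on_dyadic_grid x0 h0 K)"
  proof induction
    case (root R)
    then obtain x0 h0 where h: "h0 > 0" and
      R: "\<forall>K\<in>R. lev K = 0 \<and> edge K = h0 \<and>
        (\<exists>k :: int^'a. corner K = x0 + h0 *\<^sub>R (\<chi> i. of_int (k $ i)))"
      unfolding root_mesh_def by blast
    then have "\<forall>K\<in>R. on_dyadic_grid x0 h0 K"
      unfolding on_dyadic_grid_def by simp
    with h show ?case by blast
  next
    case (refine T K)
    then obtain x0 h0 where "h0 > 0" "\<forall>K\<in>T. on_dyadic_grid x0 h0 K" by blast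
    then have "h0 > 0 \<and> (\<forall>C\<in>T - {K} \<union> children K. on_dyadic_grid x0 h0 C)"
      using on_dyadic_grid_child \<open>K \<in> T\<close> unfolding children_def by blast
    then show ?case by blast
  qed
  then show thesis using that by blast
qed

lemma mem_cell_set:
  "x \<in> cell_set K \<longleftrightarrow> (\<forall>i. corner K $ i \<le> x $ i \<and> x $ i \<le> corner K $ i + edge K)"
  by (simp add: cell_set_def mem_box_cart)


section \<open>The subface of a shadow child\<close>

text \<open>Used contrapositively: a \<open>(d - 1)\<close>-dimensional set is constant along at most one axis.\<close>

lemma aff_dim_two_constant_coords:
  fixes S :: "(real^'d::finite) set"
  assumes "i \<noteq> j" "S \<subseteq> {x. x $ i = a \<and> x $ j = b}"
  shows "aff_dim S \<le> int CARD('d) - 2"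
proof -
  let ?V = "{x :: real^'d. \<forall>k. k \<notin> UNIV - {i, j} \<longrightarrow> x $ k = 0}"
  let ?z = "axis i a + axis j b :: real^'d"
  have "{x. x $ i = a \<and> x $ j = b} \<subseteq> (+) ?z ` ?V"
  proof
    fix x :: "real^'d" assume "x \<in> {x. x $ i = a \<and> x $ j = b}"
    then have "x - ?z \<in> ?V" using \<open>i \<noteq> j\<close> by (auto simp: axis_def)
    moreover have "x = ?z + (x - ?z)" by simp
    ultimately show "x \<in> (+) ?z ` ?V" by blast
  qed
  then have "aff_dim S \<le> aff_dim ((+) ?z ` ?V)"
    using assms(2) by (intro aff_dim_subset) blast
  also have "\<dots> = aff_dim ?V" by (rule aff_dim_translation_eq)
  also have "\<dots> = int (dim ?V)"
    by (rule aff_dim_subspace) (auto simp: subspace_def)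
  also have "dim ?V = card (UNIV - {i, j})" unfolding dim_vec_eq[symmetric] by (rule dim_substandard_cart)
  also have "int \<dots> = int CARD('d) - 2"
  proof -
    have "card {i, j} = 2" using \<open>i \<noteq> j\<close> by simp
    moreover have "card {i, j} \<le> CARD('d)" by (rule card_mono) auto
    ultimately show ?thesis by (simp add: card_Diff_subset)
  qed
  finally show ?thesis .
qed

text \<open>The side \<open>r\<close> of the common face is not given: only the hyperplane that contains the
  intersection is known, and which of the two faces it cuts out is read off from the sign of the
  offset between the two corners.\<close>

lemma equal_level_cells_meet_in_face:
  fixes C C' :: "'d::finite cell"
  assumes h: "h0 > 0"
    and C: "on_dyadic_grid x0 h0 C" and C': "on_dyadic_grid x0 h0 C'" and lev: "lev C = lev C'"
    and adj: "adjacent C C'" and sub: "cell_set C \<inter> cell_set C' \<subseteq> {x. x $ j = t}"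
  obtains r where "face_coord C j r = t" "subface C C' = face C j r"
proof -
  define e where "e = edge C"
  have e: "e > 0" and e': "edge C' = e"
    using h C C' lev by (simp_all add: e_def on_dyadic_grid_def)
  from C obtain k :: "int^'d" where k: "corner C = x0 + e *\<^sub>R (\<chi> i. of_int (k $ i))"
    unfolding on_dyadic_grid_def e_def by blast
  from C' obtain k' :: "int^'d" where k': "corner C' = x0 + e *\<^sub>R (\<chi> i. of_int (k' $ i))"
    unfolding on_dyadic_grid_def e' by blast
  define m where "m i = k' $ i - k $ i" for i
  have corner': "corner C' $ i = corner C $ i + e * of_int (m i)" for i
    by (simp add: k k' m_def algebra_simps)
  have mem: "x \<in> cell_set C \<longleftrightarrow> (\<forall>i. corner C $ i \<le> x $ i \<and> x $ i \<le> corner C $ i + e)"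
    "x \<in> cell_set C' \<longleftrightarrow> (\<forall>i. corner C $ i + e * of_int (m i) \<le> x $ i \<and>
        x $ i \<le> corner C $ i + e * of_int (m i) + e)" for x
    by (simp_all only: mem_cell_set corner' e' flip: e_def)
  have "aff_dim (cell_set C \<inter> cell_set C') \<noteq> - 1"
    using adj unfolding adjacent_def by simp
  then obtain z where z: "z \<in> cell_set C" "z \<in> cell_set C'"
    using aff_dim_empty by blast
  have m: "m i = -1 \<or> m i = 0 \<or> m i = 1" for i
  proof -
    have "corner C $ i \<le> z $ i" "z $ i \<le> corner C $ i + e"
      "corner C $ i + e * of_int (m i) \<le> z $ i"
      "z $ i \<le> corner C $ i + e * of_int (m i) + e"
      using z by (simp_all add: mem)
    then have "e * of_int (m i) \<le> e * 1" "e * (- 1) \<le> e * of_int (m i)" by linarith+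
    then have "of_int (m i) \<le> (1::real)" "(- 1::real) \<le> of_int (m i)"
      using e by (simp_all only: mult_le_cancel_left_pos)
    then show ?thesis by linarith
  qed
  have const: "x $ i = face_coord C i (m i = 1)"
    if "x \<in> cell_set C \<inter> cell_set C'" "m i \<noteq> 0" for x i
  proof -
    have "corner C $ i \<le> x $ i" "x $ i \<le> corner C $ i + e"
      "corner C $ i + e * of_int (m i) \<le> x $ i"
      "x $ i \<le> corner C $ i + e * of_int (m i) + e"
      using that(1) by (simp_all add: mem)
    then show ?thesis using m[of i] that(2) by (auto simp: face_coord_def e_def[symmetric])
  qed
  have mj: "m j \<noteq> 0"
  proof
    assume "m j = 0"
    \<comment> \<open>Without an offset along \<open>j\<close>, both ends of that edge would lie in the hyperplane.\<close>
    define y where "y a = (\<chi> i. if i = j then corner C $ j + a else z $ i)" for a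
    have "y a \<in> cell_set C \<inter> cell_set C'" if "0 \<le> a" "a \<le> e" for a
      using z \<open>m j = 0\<close> that unfolding mem Int_iff y_def by auto
    from this[of 0] this[of e] have "y 0 $ j = t" "y e $ j = t" using sub e by auto
    then show False using e by (simp add: y_def)
  qed
  have mi: "m i = 0" if "i \<noteq> j" for i
  proof (rule ccontr)
    assume "m i \<noteq> 0"
    then have "cell_set C \<inter> cell_set C' \<subseteq> {x. x $ i = face_coord C i (m i = 1) \<and> x $ j = t}"
      using const sub by blast
    then have "aff_dim (cell_set C \<inter> cell_set C') \<le> int CARD('d) - 2"
      by (rule aff_dim_two_constant_coords[OF that])
    then show False using adj unfolding adjacent_def by simp
  qed
  have inter: "cell_set C \<inter> cell_set C' = face C j (m j = 1)"
  proof (intro equalityI subsetI)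
    fix x assume "x \<in> cell_set C \<inter> cell_set C'"
    then show "x \<in> face C j (m j = 1)" using const mj by (simp add: face_def)
  next
    fix x assume x: "x \<in> face C j (m j = 1)"
    have "corner C $ i + e * of_int (m i) \<le> x $ i \<and>
        x $ i \<le> corner C $ i + e * of_int (m i) + e" for i
      using x m[of j] mj mi[of i] by (cases "i = j") (auto simp: face_def mem face_coord_def e_def[symmetric])
    then show "x \<in> cell_set C \<inter> cell_set C'" using x by (simp add: mem face_def)
  qed
  have front: "frontier (cell_set D) = cell_set D - box (corner D) (corner D + edge D *\<^sub>R 1)"
    for D :: "'d cell"
    by (simp add: cell_set_def frontier_cbox)
  have "cell_set C \<inter> cell_set C' \<subseteq> frontier (cell_set C) \<inter> frontier (cell_set C')"
  proof
    fix x assume x: "x \<in> cell_set C \<inter> cell_set C'"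
    then have "x $ j = face_coord C j (m j = 1)" using const mj by simp
    then have "x $ j = corner C $ j \<or> x $ j = corner C $ j + edge C"
      "x $ j = corner C' $ j \<or> x $ j = corner C' $ j + edge C'"
      using m[of j] mj by (auto simp: face_coord_def e_def e' corner')
    then have "x \<notin> box (corner C) (corner C + edge C *\<^sub>R 1)"
      "x \<notin> box (corner C') (corner C' + edge C' *\<^sub>R 1)"
      by (auto simp: mem_box_cart intro!: exI[of _ j])
    with x show "x \<in> frontier (cell_set C) \<inter> frontier (cell_set C')" by (simp add: front)
  qed
  then have "subface C C' = face C j (m j = 1)"
    unfolding subface_def inter[symmetric] by (auto simp: front)
  moreover have "face_coord C j (m j = 1) = t"
    using const[of z j] sub z mj by auto
  ultimately show thesis using that by blast
qed

lemma child_pos_child: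
  assumes "edge K > 0"
  shows "child_pos K (child K b) = b"
proof -
  have "b' = b" if "child K b = child K b'" for b'
    using that assms by (simp add: child_def vec_eq_iff of_bool_eq_iff)
  then show ?thesis unfolding child_pos_def by blast
qed

text \<open>The plane of the coarse face contains a face of the child only if the child lies on that
  side of \<open>K\<close>, and then it is the face of the child on the same side.\<close>

lemma shadow_child_subface:
  fixes K :: "'d::finite cell"
  assumes h: "h0 > 0"
    and K: "on_dyadic_grid x0 h0 K" and K': "on_dyadic_grid x0 h0 K'" and lev: "lev K' = lev K + 1"
    and sh: "shadow_child K j s K' C"
  obtains b where "C = child K b" "b $ j = s" "subface C K' = face C j s"
proof -
  from sh obtain b where b: "C = child K b"
    unfolding shadow_child_def children_def by blast
  have e: "edge K > 0" using h K by (simp add: on_dyadic_grid_def)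
  have C: "on_dyadic_grid x0 h0 C" unfolding b by (rule on_dyadic_grid_child[OF K])
  have "lev C = lev K'" by (simp add: b child_def lev)
  moreover have "adjacent C K'" "cell_set C \<inter> cell_set K' \<subseteq> {x. x $ j = face_coord K j s}"
    using sh by (auto simp: shadow_child_def abuts_across_def face_def)
  ultimately obtain r where r: "face_coord C j r = face_coord K j s" "subface C K' = face C j r"
    using equal_level_cells_meet_in_face[OF h C K'] by blast
  have "b $ j = s \<and> r = s"
    using r(1) e by (cases "b $ j"; cases r; cases s) (simp_all add: b child_def face_coord_def)
  then show thesis using that b r(2) by simp
qed


section \<open>Equality of the integrands\<close>

text \<open>On the inward normal line through a point of the outer face, \<open>C\<close> and \<open>K\<close> contain the same
  points up to distance \<open>edge C\<close>, so restricting to the child does not change the one-sided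
  derivative.\<close>

lemma normal_deriv_restrict_child:
  fixes K :: "'d::finite cell"
  assumes e: "edge K > 0" and s: "b $ j = s" and x: "x \<in> face (child K b) j s"
  shows "normal_deriv (child K b) (- outer_normal j s) (restrict w (cell_set (child K b))) x =
         normal_deriv K (- outer_normal j s) w x"
proof -
  let ?C = "child K b" and ?n = "- outer_normal j s :: real^'d"
  let ?L = "\<lambda>D. {t. x + t *\<^sub>R ?n \<in> cell_set D}"
  have xC: "x \<in> cell_set ?C" and xj: "x $ j = face_coord ?C j s"
    using x by (auto simp: face_def)
  have sub: "cell_set ?C \<subseteq> cell_set K" by (rule child_subset) (use e in simp)
  have "t \<in> ?L ?C" if t: "t \<in> ?L K" "t < edge ?C" for t
  proof -
    have "corner ?C $ i \<le> (x + t *\<^sub>R ?n) $ i \<and> (x + t *\<^sub>R ?n) $ i \<le> corner ?C $ i + edge ?C" for i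
    proof (cases "i = j")
      case True
      have "corner K $ j \<le> (x + t *\<^sub>R ?n) $ j" "(x + t *\<^sub>R ?n) $ j \<le> corner K $ j + edge K"
        using t(1) by (auto simp: mem_cell_set)
      then show ?thesis using True t(2) xj s e
        by (cases s) (auto simp: outer_normal_def child_def face_coord_def)
    next
      case False
      then have "(x + t *\<^sub>R ?n) $ i = x $ i" by (simp add: outer_normal_def axis_def)
      then show ?thesis using xC by (simp only: mem_cell_set)
    qed
    then show ?thesis unfolding mem_Collect_eq mem_cell_set by blast
  qed
  then have "?L ?C \<inter> {..<edge ?C} - {0} = ?L K \<inter> {..<edge ?C} - {0}" using sub by blast
  then have at: "at 0 within ?L ?C = at 0 within ?L K"
    using e by (intro at_within_nhd[of 0 "{..<edge ?C}"]) (auto simp: child_def)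
  have "vector_derivative (\<lambda>t. restrict w (cell_set ?C) (x + t *\<^sub>R ?n)) (at 0 within ?L ?C) =
      vector_derivative (\<lambda>t. w (x + t *\<^sub>R ?n)) (at 0 within ?L ?C)"
    using xC by (intro vector_derivative_cong_eq) auto
  then show ?thesis unfolding normal_deriv_def at .
qed

lemma sip_integrand_embedding:
  fixes K :: "'d::finite cell"
  assumes e: "edge K > 0" and s: "b $ j = s" and x: "x \<in> face (child K b) j s"
  shows "sip_integrand (K', child K b) (- outer_normal j s) \<sigma>
           (u', embedding K u (child K b)) (v', embedding K v (child K b)) x =
         sip_integrand (K', K) (- outer_normal j s) \<sigma> (u', u) (v', v) x"
proof -
  have emb: "embedding K w (child K b) = restrict w (cell_set (child K b))" for w
    by (simp add: embedding_def children_def)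
  have "x \<in> cell_set (child K b)" using x by (simp add: face_def)
  then show ?thesis
    by (simp add: sip_integrand_def avg_normal_deriv_def jump_def emb
        normal_deriv_restrict_child[OF assms])
qed

lemma sip_form_cong:
  assumes "\<And>x. x \<in> G \<Longrightarrow> sip_integrand C n \<sigma> u v x = sip_integrand D n \<sigma> u' v' x"
  shows "sip_form \<tau> j t G C n \<sigma> u v = sip_form \<tau> j t G D n \<sigma> u' v'"
  unfolding sip_form_def surface_integral_def set_lebesgue_integral_def
  by (intro arg_cong[of _ _ uminus] Bochner_Integration.integral_cong)
    (auto simp: assms split: split_indicator)


section \<open>Equality of the quadrature rules\<close>

lemma face_map_image:
  fixes C :: "'d::finite cell" and \<tau> :: "'e::finite \<Rightarrow> 'd"
  assumes e: "edge C > 0" and \<tau>: "bij_betw \<tau> UNIV (UNIV - {j})"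
  shows "face_map \<tau> C j s ` cbox 0 1 = face C j s"
proof (intro equalityI subsetI)
  fix x assume "x \<in> face_map \<tau> C j s ` cbox 0 1"
  then obtain \<xi> where \<xi>: "\<And>i. 0 \<le> \<xi> $ i \<and> \<xi> $ i \<le> 1" and x: "x = face_map \<tau> C j s \<xi>"
    by (force simp: mem_box_cart)
  have "edge C * \<xi> $ i \<le> edge C" "0 \<le> edge C * \<xi> $ i" for i
    using \<xi>[of i] e by (simp_all add: mult_left_le)
  then show "x \<in> face C j s"
    using e by (auto simp: x face_def mem_cell_set face_map_def plane_point_def face_coord_def)
next
  fix x assume x: "x \<in> face C j s"
  define \<xi> :: "real^'e" where "\<xi> = (\<chi> i. (x $ \<tau> i - corner C $ \<tau> i) / edge C)"
  have inv: "\<tau> (inv \<tau> i) = i" if "i \<noteq> j" for i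
    using \<tau> that by (intro f_inv_into_f) (auto simp: bij_betw_def)
  have xj: "x $ j = face_coord C j s" and
    "corner C $ i \<le> x $ i" "x $ i \<le> corner C $ i + edge C" for i
    using x by (simp_all add: face_def mem_cell_set)
  then have "\<xi> \<in> cbox 0 1"
    using e by (auto simp: \<xi>_def mem_box_cart field_simps)
  moreover have "x = face_map \<tau> C j s \<xi>"
    using e xj by (auto simp: vec_eq_iff face_map_def plane_point_def \<xi>_def inv face_coord_def)
  ultimately show "x \<in> face_map \<tau> C j s ` cbox 0 1" by blast
qed

lemma face_map_ref_subface_map:
  fixes K :: "'d::finite cell" and \<tau> :: "'e::finite \<Rightarrow> 'd"
  assumes e: "edge K > 0" and s: "b $ j = s" and \<tau>: "bij_betw \<tau> UNIV (UNIV - {j})"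
  shows "face_map \<tau> K j s \<circ> ref_subface_map \<tau> K (child K b) = face_map \<tau> (child K b) j s"
proof -
  have "\<tau> (inv \<tau> i) = i" if "i \<noteq> j" for i
    using \<tau> that by (intro f_inv_into_f) (auto simp: bij_betw_def)
  moreover have "ref_subface_map \<tau> K (child K b) \<xi> = (\<chi> i. (\<xi> $ i + of_bool (b $ \<tau> i)) / 2)"
    for \<xi> :: "real^'e"
    by (simp add: ref_subface_map_def child_pos_child[OF e] vec_eq_iff)
  ultimately show ?thesis
    using s by (auto simp: fun_eq_iff vec_eq_iff face_map_def plane_point_def child_def field_simps)
qed

lemma subface_rule_eq_same_level_rule:
  assumes "edge K > 0" "b $ j = s" "bij_betw \<tau> UNIV (UNIV - {j})"
  shows "subface_rule \<tau> K (child K b) j s Q = same_level_rule \<tau> (child K b) j s Q"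
proof -
  have "face_map \<tau> K j s (ref_subface_map \<tau> K (child K b) \<xi>) = face_map \<tau> (child K b) j s \<xi>" for \<xi>
    using face_map_ref_subface_map[OF assms] by (metis comp_apply)
  then show ?thesis
    by (auto simp: subface_rule_def same_level_rule_def map_rule_def child_def power_divide)
qed

text \<open>The integrands are known to agree on the face only, which is why the nodes must lie in the
  reference face.\<close>

lemma sip_quad_same_level_rule_cong:
  assumes "edge C > 0" "bij_betw \<tau> UNIV (UNIV - {j})" "reference_rule Q"
    and "\<And>x. x \<in> face C j s \<Longrightarrow> sip_integrand D n \<sigma> u v x = sip_integrand D' n \<sigma> u' v' x"
  shows "sip_quad (same_level_rule \<tau> C j s Q) D n \<sigma> u v =
    sip_quad (same_level_rule \<tau> C j s Q) D' n \<sigma> u' v'"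
proof -
  have "x \<in> face C j s" if "(x, w) \<in> set (same_level_rule \<tau> C j s Q)" for x w
    using that assms(3) face_map_image[OF assms(1,2), of s]
    by (fastforce simp: same_level_rule_def map_rule_def reference_rule_def)
  then have "map (\<lambda>(x, w). w * sip_integrand D n \<sigma> u v x) (same_level_rule \<tau> C j s Q) =
      map (\<lambda>(x, w). w * sip_integrand D' n \<sigma> u' v' x) (same_level_rule \<tau> C j s Q)"
    using assms(4) by auto
  then show ?thesis unfolding sip_quad_def apply_rule_def by (simp only:)
qed


section \<open>The non-matching interface\<close>

theorem theorem1:
  fixes T :: "'d::finite cell set" and p :: nat
    and K :: "'d cell" and j :: 'd and s :: bool
    and K' Kc :: "nat \<Rightarrow> 'd cell"
    and u v :: "'d cell \<Rightarrow> real^'d \<Rightarrow> real"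
    and \<sigma> :: "real \<Rightarrow> real"
    and \<tau> :: "'e::finite \<Rightarrow> 'd" and Q :: "((real^'e) \<times> real) list"
  assumes "CARD('d) \<in> {2, 3}"
    and "active_mesh T"
    and "nonmatching_interface T K j s K'"
    and "\<And>c. c \<in> {1..2 ^ (CARD('d) - 1)} \<Longrightarrow> shadow_child K j s (K' c) (Kc c)"
    and "u \<in> V_DG T p" and "v \<in> V_DG T p"
    and "penalty p \<sigma>"
    and "bij_betw \<tau> UNIV (UNIV - {j})"
    and "reference_rule Q"
  shows
    "(\<Sum>c\<in>{1..2 ^ (CARD('d) - 1)}.
        sip_form \<tau> j (face_coord K j s) (subface (Kc c) (K' c)) (K' c, Kc c)
          (- outer_normal j s) (\<sigma> (edge (K' c)))
          (u (K' c), embedding K (u K) (Kc c)) (v (K' c), embedding K (v K) (Kc c))) =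
     (\<Sum>c\<in>{1..2 ^ (CARD('d) - 1)}.
        sip_form \<tau> j (face_coord K j s) (subface (Kc c) (K' c)) (K' c, K)
          (- outer_normal j s) (\<sigma> (edge (K' c)))
          (u (K' c), u K) (v (K' c), v K))
     \<and>
     (\<forall>c\<in>{1..2 ^ (CARD('d) - 1)}.
        face_map \<tau> (Kc c) j s ` cbox 0 1 = subface (Kc c) (K' c) \<and>
        (face_map \<tau> K j s \<circ> ref_subface_map \<tau> K (Kc c)) ` cbox 0 1 = subface (Kc c) (K' c) \<and>
        (\<forall>x\<in>subface (Kc c) (K' c).
           sip_integrand (K' c, Kc c) (- outer_normal j s) (\<sigma> (edge (K' c)))
             (u (K' c), embedding K (u K) (Kc c)) (v (K' c), embedding K (v K) (Kc c)) x =
           sip_integrand (K' c, K) (- outer_normal j s) (\<sigma> (edge (K' c)))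
             (u (K' c), u K) (v (K' c), v K) x))
     \<and>
     (\<Sum>c\<in>{1..2 ^ (CARD('d) - 1)}.
        sip_quad (same_level_rule \<tau> (Kc c) j s Q) (K' c, Kc c)
          (- outer_normal j s) (\<sigma> (edge (K' c)))
          (u (K' c), embedding K (u K) (Kc c)) (v (K' c), embedding K (v K) (Kc c))) =
     (\<Sum>c\<in>{1..2 ^ (CARD('d) - 1)}.
        sip_quad (subface_rule \<tau> K (Kc c) j s Q) (K' c, K)
          (- outer_normal j s) (\<sigma> (edge (K' c)))
          (u (K' c), u K) (v (K' c), v K))"
proof -
  let ?I = "{1..2 ^ (CARD('d) - 1)} :: nat set"
  from assms(2) obtain x0 h0 where h: "h0 > 0" and
    grid: "\<And>K. K \<in> T \<Longrightarrow> on_dyadic_grid x0 h0 K"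
    unfolding active_mesh_def using hierarchical_mesh_on_dyadic_grid by blast
  have K: "on_dyadic_grid x0 h0 K"
    using assms(3) grid by (simp add: nonmatching_interface_def)
  then have e: "edge K > 0" using h by (simp add: on_dyadic_grid_def)
  have sub: "\<exists>b. Kc c = child K b \<and> b $ j = s \<and> subface (Kc c) (K' c) = face (Kc c) j s"
    if "c \<in> ?I" for c
  proof -
    have "on_dyadic_grid x0 h0 (K' c)" "lev (K' c) = lev K + 1"
      using assms(3) grid that by (simp_all add: nonmatching_interface_def)
    then show ?thesis using shadow_child_subface[OF h K _ _ assms(4)[OF that]] by blast
  qed
  have eC: "edge (child K b) > 0" for b using e by (simp add: child_def)
  have integrand: "sip_integrand (K' c, Kc c) (- outer_normal j s) (\<sigma> (edge (K' c)))
        (u (K' c), embedding K (u K) (Kc c)) (v (K' c), embedding K (v K) (Kc c)) x =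
      sip_integrand (K' c, K) (- outer_normal j s) (\<sigma> (edge (K' c)))
        (u (K' c), u K) (v (K' c), v K) x"
    if "c \<in> ?I" "x \<in> subface (Kc c) (K' c)" for c x
  proof -
    from sub[OF that(1)] obtain b where b: "Kc c = child K b" "b $ j = s"
      "subface (Kc c) (K' c) = face (Kc c) j s" by blast
    have "x \<in> face (child K b) j s" using that(2) b(1,3) by simp
    from sip_integrand_embedding[where b = b, OF e b(2) this] show ?thesis unfolding b(1) .
  qed
  have images: "face_map \<tau> (Kc c) j s ` cbox 0 1 = subface (Kc c) (K' c)"
    "(face_map \<tau> K j s \<circ> ref_subface_map \<tau> K (Kc c)) ` cbox 0 1 = subface (Kc c) (K' c)"
    if "c \<in> ?I" for c
  proof -
    from sub[OF that] obtain b where b: "Kc c = child K b" "b $ j = s"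
      "subface (Kc c) (K' c) = face (Kc c) j s" by blast
    show "face_map \<tau> (Kc c) j s ` cbox 0 1 = subface (Kc c) (K' c)"
      unfolding b(3) unfolding b(1) by (rule face_map_image[OF eC assms(8)])
    then show "(face_map \<tau> K j s \<circ> ref_subface_map \<tau> K (Kc c)) ` cbox 0 1 = subface (Kc c) (K' c)"
      unfolding b(1) face_map_ref_subface_map[OF e b(2) assms(8)] .
  qed
  have quad: "sip_quad (same_level_rule \<tau> (Kc c) j s Q) (K' c, Kc c)
        (- outer_normal j s) (\<sigma> (edge (K' c)))
        (u (K' c), embedding K (u K) (Kc c)) (v (K' c), embedding K (v K) (Kc c)) =
      sip_quad (subface_rule \<tau> K (Kc c) j s Q) (K' c, K)
        (- outer_normal j s) (\<sigma> (edge (K' c)))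
        (u (K' c), u K) (v (K' c), v K)"
    if c: "c \<in> ?I" for c
  proof -
    from sub[OF c] obtain b where b: "Kc c = child K b" "b $ j = s"
      "subface (Kc c) (K' c) = face (Kc c) j s" by blast
    have rule: "subface_rule \<tau> K (Kc c) j s Q = same_level_rule \<tau> (Kc c) j s Q"
      unfolding b(1) by (rule subface_rule_eq_same_level_rule[OF e b(2) assms(8)])
    have "edge (Kc c) > 0" unfolding b(1) by (rule eC)
    then show ?thesis
      unfolding rule using integrand[OF c, unfolded b(3)]
      by (rule sip_quad_same_level_rule_cong[OF _ assms(8,9)])
  qed
  show ?thesis
    by (intro conjI ballI sum.cong sip_form_cong images integrand quad refl; assumption)
qed

end
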